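(* Let $G$ be a finite Abelian group and let $g\in\mathbb{C}^G\setminus\{0\}$. The following are equivalent: 1. Every minor of $A_{G,g}$ of order $|G|$ is nonzero. 2. The vectors of the Gabor system $\{\pi(\lambda)g\}_{\lambda\in G\times\widehat G}$ are in general position. 3. The Gabor system $\{\pi(\lambda)g\}_{\lambda\in G\times\widehat G}$ is an equal norm tight frame which is maximally robust to erasures. 4. For all $f\in\mathbb{C}^G\setminus\{0\}$ we have $\|V_gf\|_0\ge|G|^2-|G|+1$. 5. For all $f\in\mathbb{C}^G$, $V_gf$, and therefore $f$, is completely determined by the values of $V_gf$ on any set $\Lambda\subseteq G\times\widehat G$ with $|\Lambda|=|G|$. 6. For every $\Lambda\subseteq G\times\widehat G$: $\mathcal{H}_\Lambda$ is identifiable by $g$ if and only if $|\Lambda|\le|G|$.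
   Context: $\mathbb{C}^G$ is the space of functions $G\to\mathbb{C}$ with inner product $\langle f,h\rangle=\sum_{y}f(y)\overline{h(y)}$ and induced norm $\|\cdot\|_2$; $\|F\|_0$ is the number of points where a function $F$ is nonzero. $\widehat G$ is the dual group of $G$ (homomorphisms $\xi:G\to\{z\in\mathbb{C}:|z|=1\}$, $\langle\xi,x\rangle=\xi(x)$). For $\lambda=(x,\xi)\in G\times\widehat G$ the time-frequency shift operator is $\pi(\lambda)f(y)=\langle\xi,y\rangle f(y-x)$. The short-time Fourier transform is $V_gf(\lambda)=\langle f,\pi(\lambda)g\rangle$, $\lambda\in G\times\widehat G$. $A_{G,g}$ is the $|G|^2\times|G|$ matrix (rows indexed by $G\times\widehat G$, columns by $G$) representing the linear map $f\mapsto V_gf$; i.e. its entry at $(\lambda,y)$ is $\overline{(\pi(\lambda)g)(y)}$. A minor of order $r$ is the determinant of an $r\times r$ submatrix. A family $\{\varphi_k\}_{k\in K}\subset\mathbb{C}^G$ ($K$ finite) is a frame for $\mathbb{C}^G$ if there are $A,B>0$ with $A\|f\|_2^2\le\sum_k|\langle f,\varphi_k\rangle|^2\le B\|f\|_2^2$ for all $f\in\mathbb{C}^G$; it is tight if one can take $A=B$, and equal norm if $\|\varphi_k\|_2$ is a positive constant independent of $k$. A frame $\{\varphi_k\}_{k\in K}$ is maximally robust to erasures if the removal of any $l\le|K|-|G|$ vectors from it leaves a frame. A family of $m$ vectors in $\mathbb{C}^G$ is in general position if any collection of at most $|G|$ of these vectors is linearly independent. A linear space $\mathcal{H}$ of operators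 $\mathbb{C}^G\to\mathbb{C}^G$ is identifiable by $g\in\mathbb{C}^G$ if the linear map $\mathcal{H}\to\mathbb{C}^G$, $H\mapsto Hg$, is injective. For $\Lambda\subseteq G\times\widehat G$, $\mathcal{H}_\Lambda=\{\sum_{\lambda\in\Lambda}c_\lambda\pi(\lambda):\ c_\lambda\in\mathbb{C}\}$. *)

theory Defs
  imports "HOL-Analysis.Analysis"
begin

text \<open>
  A finite Abelian group is a type \<open>'g :: {finite, ab_group_add}\<close>, written additively, and
  the space of functions from it to the complex numbers is \<^typ>\<open>complex ^ 'g\<close>.  Its complex
  vector space structure is \<open>(*s)\<close>, so complex linear independence is \<open>vec.independent\<close>;
  \<open>inner\<close>, \<open>(*\<^sub>R)\<close> and \<open>independent\<close> refer to the underlying real structure instead.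
\<close>

type_synonym 'g signal = "(complex, 'g) vec"

definition cinner :: "complex ^ 'n \<Rightarrow> complex ^ 'n \<Rightarrow> complex" where
  "cinner f h = (\<Sum>y\<in>UNIV. f $ y * cnj (h $ y))"

text \<open>The norm induced by \<open>cinner\<close> is the library's \<open>norm\<close>.\<close>

lemma cinner_self: "cinner f f = complex_of_real ((norm f)\<^sup>2)"
  by (simp add: cinner_def norm_vec_def L2_set_def sum_nonneg complex_norm_square del: of_real_power)

definition l0_norm :: "complex ^ 'n \<Rightarrow> nat" where
  "l0_norm F = card {k. F $ k \<noteq> 0}"


subsection \<open>The dual group\<close>

typedef (overloaded) 'g character =
  "{\<xi> :: 'g::ab_group_add \<Rightarrow> complex. (\<forall>x. cmod (\<xi> x) = 1) \<and> (\<forall>x y. \<xi> (x + y) = \<xi> x * \<xi> y)}"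
  morphisms char_apply Character
  by (rule exI[of _ "\<lambda>_. 1"]) simp

lemma char_apply_norm: "cmod (char_apply \<xi> x) = 1"
  using char_apply[of \<xi>] by simp

lemma char_apply_add: "char_apply \<xi> (x + y) = char_apply \<xi> x * char_apply \<xi> y"
  using char_apply[of \<xi>] by simp

lemma char_apply_power_card:
  fixes \<xi> :: "'g::{finite, ab_group_add} character"
  shows "char_apply \<xi> x ^ CARD('g) = 1"
proof -
  let ?P = "\<Prod>y\<in>UNIV. char_apply \<xi> y"
  have "?P = (\<Prod>y\<in>UNIV. char_apply \<xi> (x + y))"
    by (rule prod.reindex_bij_witness[of _ "\<lambda>y. x + y" "\<lambda>y. y - x"]) auto
  also have "\<dots> = char_apply \<xi> x ^ CARD('g) * ?P"
    by (simp add: char_apply_add prod.distrib)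
  finally have "?P = char_apply \<xi> x ^ CARD('g) * ?P" .
  moreover have "?P \<noteq> 0"
    using char_apply_norm[of \<xi>] by (metis norm_zero prod_zero_iff finite zero_neq_one)
  ultimately show ?thesis by simp
qed

instance character :: ("{finite, ab_group_add}") finite
proof
  let ?R = "{z :: complex. z ^ CARD('a) = 1}"
  have "finite ?R"
    by (rule finite_roots_unity) (simp add: Suc_le_eq)
  then have "finite (UNIV \<rightarrow>\<^sub>E ?R :: ('a \<Rightarrow> complex) set)"
    by (intro finite_PiE) auto
  moreover have "range (char_apply :: 'a character \<Rightarrow> _) \<subseteq> UNIV \<rightarrow>\<^sub>E ?R"
    by (auto simp: char_apply_power_card)
  ultimately have "finite (range (char_apply :: 'a character \<Rightarrow> _))"
    by (rule finite_subset[rotated])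
  then show "finite (UNIV :: 'a character set)"
    by (rule finite_imageD) (auto simp: inj_on_def char_apply_inject)
qed


subsection \<open>Time-frequency analysis\<close>

definition tf_shift ::
    "'g \<times> 'g character \<Rightarrow> 'g signal \<Rightarrow> 'g::{finite, ab_group_add} signal" where
  "tf_shift l f = (\<chi> y. char_apply (snd l) y * f $ (y - fst l))"

definition stft ::
    "'g signal \<Rightarrow> 'g signal \<Rightarrow> complex ^ ('g::{finite, ab_group_add} \<times> 'g character)" where
  "stft g f = (\<chi> l. cinner f (tf_shift l g))"

definition gabor_matrix ::
    "'g signal \<Rightarrow> 'g signal ^ ('g::{finite, ab_group_add} \<times> 'g character)" where
  "gabor_matrix g = (\<chi> l y. cnj (tf_shift l g $ y))"

lemma gabor_matrix_mult: "gabor_matrix g *v f = stft g f"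
  by (simp add: gabor_matrix_def stft_def cinner_def matrix_vector_mult_def mult.commute vec_eq_iff)

text \<open>
  For injective \<open>\<rho>\<close> and \<open>\<kappa>\<close> this is the minor of order \<open>CARD('k)\<close> with rows \<open>range \<rho>\<close> and
  columns \<open>range \<kappa>\<close>; enumerating these in a different order only affects its sign.
\<close>

definition minor :: "('k::finite \<Rightarrow> 'm) \<Rightarrow> ('k \<Rightarrow> 'n) \<Rightarrow> complex ^ 'n ^ 'm \<Rightarrow> complex" where
  "minor \<rho> \<kappa> A = det (\<chi> i j. A $ \<rho> i $ \<kappa> j)"


subsection \<open>Families of vectors, frames\<close>

text \<open>
  Families carry multiplicities: a family is linearly independent iff its members
  are pairwise distinct and form a linearly independent set.
\<close>

definition general_position :: "'k set \<Rightarrow> ('k \<Rightarrow> complex ^ 'n) \<Rightarrow> bool" where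
  "general_position K \<phi> \<longleftrightarrow>
     (\<forall>S\<subseteq>K. finite S \<and> card S \<le> CARD('n) \<longrightarrow> inj_on \<phi> S \<and> vec.independent (\<phi> ` S))"

definition frame_bounds :: "real \<Rightarrow> real \<Rightarrow> 'k set \<Rightarrow> ('k \<Rightarrow> complex ^ 'n) \<Rightarrow> bool" where
  "frame_bounds A B K \<phi> \<longleftrightarrow> finite K \<and> A > 0 \<and> B > 0 \<and>
     (\<forall>f. A * (norm f)\<^sup>2 \<le> (\<Sum>k\<in>K. (cmod (cinner f (\<phi> k)))\<^sup>2) \<and>
          (\<Sum>k\<in>K. (cmod (cinner f (\<phi> k)))\<^sup>2) \<le> B * (norm f)\<^sup>2)"

definition is_frame :: "'k set \<Rightarrow> ('k \<Rightarrow> complex ^ 'n) \<Rightarrow> bool" where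
  "is_frame K \<phi> \<longleftrightarrow> (\<exists>A B. frame_bounds A B K \<phi>)"

definition tight_frame :: "'k set \<Rightarrow> ('k \<Rightarrow> complex ^ 'n) \<Rightarrow> bool" where
  "tight_frame K \<phi> \<longleftrightarrow> (\<exists>A. frame_bounds A A K \<phi>)"

definition equal_norm :: "'k set \<Rightarrow> ('k \<Rightarrow> complex ^ 'n) \<Rightarrow> bool" where
  "equal_norm K \<phi> \<longleftrightarrow> (\<exists>c>0. \<forall>k\<in>K. norm (\<phi> k) = c)"

text \<open>The bound on the number of erasures is written without the truncating subtraction on \<^typ>\<open>nat\<close>.\<close>

definition maximally_robust :: "'k set \<Rightarrow> ('k \<Rightarrow> complex ^ 'n) \<Rightarrow> bool" where
  "maximally_robust K \<phi> \<longleftrightarrow> is_frame K \<phi> \<and>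
     (\<forall>L\<subseteq>K. card L + CARD('n) \<le> card K \<longrightarrow> is_frame (K - L) \<phi>)"


subsection \<open>Identifiability\<close>

definition operator_space ::
    "('g \<times> 'g character) set \<Rightarrow> ('g signal \<Rightarrow> 'g::{finite, ab_group_add} signal) set" where
  "operator_space \<Lambda> = {(\<lambda>f. \<Sum>l\<in>\<Lambda>. c l *s tf_shift l f) | c. True}"

definition identifiable_by :: "(complex ^ 'n \<Rightarrow> complex ^ 'n) set \<Rightarrow> complex ^ 'n \<Rightarrow> bool" where
  "identifiable_by \<H> g \<longleftrightarrow> inj_on (\<lambda>H. H g) \<H>"


definition all_equivalent :: "bool list \<Rightarrow> bool" where
  "all_equivalent Ps \<longleftrightarrow> (\<forall>P\<in>set Ps. \<forall>Q\<in>set Ps. P \<longleftrightarrow> Q)"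

end

theory Submission
  imports Defs
begin

text \<open>
  Write \<open>N\<close> for the order of the group \<open>G\<close>, and call a family of vectors separating if the zero
  vector is the only one orthogonal to all of its members.  Each of the six conditions is shown to
  say that every subfamily of the Gabor system with exactly \<open>N\<close> members is separating, or,
  equivalently since there are \<open>N\<close> vectors in dimension \<open>N\<close>, that every such subfamily is
  linearly independent.

  Most of this is linear algebra valid for any finite family in \<open>N\<close>-dimensional space.  A minor of
  order \<open>N\<close> is nonzero iff the corresponding rows of the matrix have trivial common kernel
  (\<open>minors_nonzero_iff\<close>); a subfamily is a frame iff it is separating (\<open>is_frame_iff_separating\<close>),
  so that robustness to erasures concerns the subfamilies with at least \<open>N\<close> members; the support of
  \<open>V\<^sub>g f\<close> has at most \<open>N\<^sup>2 - N\<close> points iff \<open>V\<^sub>g f\<close> vanishes on some set of size \<open>N\<close>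
  (\<open>l0_norm_ge_iff\<close>); and determination of \<open>f\<close> by the values on such a set is the same by linearity.

  Three facts use the group.  There are \<open>N\<^sup>2\<close> time-frequency shifts (\<open>card_character\<close>).  The Gabor
  system of a nonzero window is always a tight frame (\<open>tight_frame_tf_shift\<close>).  The shift operators
  are linearly independent (\<open>tf_shift_independent\<close>), so that the operators spanned by
  \<open>\<Lambda>\<close> are identifiable by \<open>g\<close> iff the vectors \<open>\<pi>(\<lambda>)g\<close> with \<open>\<lambda> \<in> \<Lambda>\<close> are linearly independent.
  All three rest on the orthogonality relations for characters.  The relation for sums over the
  dual group needs a character that is nontrivial at a given nonzero element
  (\<open>character_separates\<close>); it is obtained by extending characters from subgroups.
\<close>

section \<open>Characters of a finite Abelian group\<close>

text \<open>The multiple \<open>n x\<close> of an element of an additive group.\<close>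

primrec nat_scale :: "nat \<Rightarrow> 'a::ab_group_add \<Rightarrow> 'a" where
  "nat_scale 0 x = 0"
| "nat_scale (Suc n) x = x + nat_scale n x"

lemma nat_scale_add: "nat_scale (m + n) x = nat_scale m x + nat_scale n x"
  by (induction m) (simp_all add: add.assoc)

lemma nat_scale_mult: "nat_scale (m * n) x = nat_scale m (nat_scale n x)"
  by (induction m) (simp_all add: nat_scale_add)

lemma nat_scale_zero [simp]: "nat_scale n 0 = 0"
  by (induction n) simp_all

lemma nat_scale_card:
  fixes x :: "'g::{finite, ab_group_add}"
  shows "nat_scale CARD('g) x = 0"
proof -
  have sum_const: "(\<Sum>y\<in>S. x) = nat_scale (card S) x" if "finite S" for S :: "'g set"
    using that by (induction S rule: finite_induct) simp_all
  have "(\<Sum>y\<in>UNIV. y) = (\<Sum>y\<in>UNIV. x + y)"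
    by (rule sum.reindex_bij_witness[of _ "\<lambda>y. x + y" "\<lambda>y. y - x"]) auto
  also have "\<dots> = nat_scale CARD('g) x + (\<Sum>y\<in>UNIV. y)"
    by (simp add: sum.distrib sum_const)
  finally show ?thesis by simp
qed

text \<open>
  \<open>H\<close> is a subgroup and \<open>\<psi>\<close> restricts to a homomorphism from \<open>H\<close> to the unit circle; the values of
  \<open>\<psi>\<close> outside \<open>H\<close> are irrelevant.
\<close>

definition partial_character :: "'g::ab_group_add set \<Rightarrow> ('g \<Rightarrow> complex) \<Rightarrow> bool" where
  "partial_character H \<psi> \<longleftrightarrow>
     0 \<in> H \<and> (\<forall>x\<in>H. \<forall>y\<in>H. x + y \<in> H) \<and> (\<forall>x\<in>H. - x \<in> H) \<and>
     (\<forall>x\<in>H. cmod (\<psi> x) = 1) \<and> (\<forall>x\<in>H. \<forall>y\<in>H. \<psi> (x + y) = \<psi> x * \<psi> y)"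

context
  fixes H :: "'g::ab_group_add set" and \<psi> :: "'g \<Rightarrow> complex"
  assumes pc: "partial_character H \<psi>"
begin

lemma partial_character_zero_mem: "0 \<in> H"
  and partial_character_add_mem: "x \<in> H \<Longrightarrow> y \<in> H \<Longrightarrow> x + y \<in> H"
  and partial_character_uminus_mem: "x \<in> H \<Longrightarrow> - x \<in> H"
  and partial_character_norm: "x \<in> H \<Longrightarrow> cmod (\<psi> x) = 1"
  and partial_character_add: "x \<in> H \<Longrightarrow> y \<in> H \<Longrightarrow> \<psi> (x + y) = \<psi> x * \<psi> y"
  using pc unfolding partial_character_def by blast+

lemma partial_character_diff_mem: "x \<in> H \<Longrightarrow> y \<in> H \<Longrightarrow> x - y \<in> H"
  using partial_character_add_mem[of x "- y"] partial_character_uminus_mem[of y] by simp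

lemma partial_character_zero: "\<psi> 0 = 1"
  using partial_character_add[of 0 0] partial_character_norm[of 0] partial_character_zero_mem
  by auto

lemma partial_character_nat_scale:
  "x \<in> H \<Longrightarrow> nat_scale n x \<in> H \<and> \<psi> (nat_scale n x) = \<psi> x ^ n"
  by (induction n)
    (simp_all add: partial_character_zero_mem partial_character_zero
      partial_character_add_mem partial_character_add)

end

text \<open>
  Let \<open>m \<ge> 2\<close> be the order of \<open>y\<close> modulo \<open>H\<close>.  The value at \<open>y\<close> of an extension to the subgroup
  generated by \<open>H\<close> and \<open>y\<close> may be any \<open>m\<close>-th root of the value at \<open>m y\<close>, and one of the \<open>m\<close>
  roots differs from 1.  The last fact makes this single lemma serve both to reach a nontrivial value
  at a given element and to extend further.
\<close>

lemma partial_character_extend: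
  fixes y :: "'g::{finite, ab_group_add}"
  assumes pc: "partial_character H \<psi>" and y: "y \<notin> H"
  obtains H' \<psi>' where "partial_character H' \<psi>'" "H \<subseteq> H'" "y \<in> H'" "\<psi>' y \<noteq> 1"
    "\<And>x. x \<in> H \<Longrightarrow> \<psi>' x = \<psi> x"
proof -
  note zero_mem = partial_character_zero_mem[OF pc] and add_mem = partial_character_add_mem[OF pc]
    and uminus_mem = partial_character_uminus_mem[OF pc] and diff_mem = partial_character_diff_mem[OF pc]
    and scale = partial_character_nat_scale[OF pc]
  define m where "m = (LEAST n. 0 < n \<and> nat_scale n y \<in> H)"
  have "0 < CARD('g) \<and> nat_scale CARD('g) y \<in> H"
    using zero_mem by (simp add: nat_scale_card)
  then have m: "0 < m \<and> nat_scale m y \<in> H"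
    unfolding m_def by (rule LeastI)
  have m_le: "m \<le> n" if "0 < n" "nat_scale n y \<in> H" for n
    unfolding m_def using that by (intro Least_le) simp
  have "m \<noteq> 1"
    using m y by auto
  with m have m2: "2 \<le> m" by simp
  let ?c = "\<psi> (nat_scale m y)"
  have norm_c: "cmod ?c = 1"
    using m partial_character_norm[OF pc] by blast
  have "card {z. z ^ m = ?c} = m"
    using m norm_c by (intro card_nth_roots) auto
  then have "\<not> {z. z ^ m = ?c} \<subseteq> {1}"
    using m2 card_mono[of "{1::complex}" "{z. z ^ m = ?c}"] by auto
  then obtain w where w: "w ^ m = ?c" "w \<noteq> 1" by auto
  have norm_w: "cmod w = 1"
  proof (rule power_eq_imp_eq_base)
    show "cmod w ^ m = 1 ^ m"
      using w(1) norm_c by (simp flip: norm_power)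
  qed (use m in auto)
  have power_w: "\<psi> (nat_scale n y) = w ^ n" if n: "nat_scale n y \<in> H" for n
  proof -
    have split: "nat_scale n y = nat_scale (n div m) (nat_scale m y) + nat_scale (n mod m) y"
      by (metis nat_scale_add nat_scale_mult div_mult_mod_eq)
    then have "nat_scale (n mod m) y = nat_scale n y - nat_scale (n div m) (nat_scale m y)"
      by simp
    then have "nat_scale (n mod m) y \<in> H"
      using n m scale diff_mem by metis
    then have "n mod m = 0"
      using m_le[of "n mod m"] m mod_less_divisor[of m n] by (meson gr_zeroI not_le)
    then show ?thesis
      using split scale[of "nat_scale m y" "n div m"] m
      by (auto simp flip: w(1) power_mult)
  qed
  have wd: "\<psi> (z - nat_scale j y) * w ^ j = \<psi> (z - nat_scale k y) * w ^ k"
    if H: "z - nat_scale j y \<in> H" "z - nat_scale k y \<in> H" and "j \<le> k" for z j k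
  proof -
    have k: "nat_scale k y = nat_scale (k - j) y + nat_scale j y"
      using \<open>j \<le> k\<close> by (simp flip: nat_scale_add)
    have eq: "z - nat_scale j y = (z - nat_scale k y) + nat_scale (k - j) y"
      using k by simp
    have mem: "nat_scale (k - j) y \<in> H"
      using diff_mem[OF H] k by simp
    have "\<psi> (z - nat_scale j y) = \<psi> (z - nat_scale k y) * w ^ (k - j)"
      unfolding eq partial_character_add[OF pc H(2) mem] power_w[OF mem] ..
    then show ?thesis
      using \<open>j \<le> k\<close> by (simp add: mult.assoc flip: power_add)
  qed
  \<comment> \<open>The multiples with natural coefficients suffice, because the group is finite.\<close>
  define H' where "H' = {z. \<exists>k. z - nat_scale k y \<in> H}"
  define \<psi>' where "\<psi>' z = (let k = (SOME k. z - nat_scale k y \<in> H) in \<psi> (z - nat_scale k y) * w ^ k)" for z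
  have \<psi>'_eq: "\<psi>' z = \<psi> (z - nat_scale k y) * w ^ k" if "z - nat_scale k y \<in> H" for z k
    using that wd[of z k "SOME k. z - nat_scale k y \<in> H"] wd[of z "SOME k. z - nat_scale k y \<in> H" k]
      someI[of "\<lambda>k. z - nat_scale k y \<in> H" k]
    unfolding \<psi>'_def Let_def by (metis nle_le)
  have "partial_character H' \<psi>'"
    unfolding partial_character_def
  proof (intro conjI ballI)
    show "0 \<in> H'"
      unfolding H'_def using zero_mem by (auto intro!: exI[of _ 0])
  next
    fix a b assume "a \<in> H'" "b \<in> H'"
    then obtain j k where j: "a - nat_scale j y \<in> H" and k: "b - nat_scale k y \<in> H"
      unfolding H'_def by blast
    have eq: "a + b - nat_scale (j + k) y = (a - nat_scale j y) + (b - nat_scale k y)"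
      by (simp add: nat_scale_add)
    have mem: "a + b - nat_scale (j + k) y \<in> H"
      unfolding eq by (rule add_mem[OF j k])
    then show "a + b \<in> H'"
      unfolding H'_def by blast
    show "\<psi>' (a + b) = \<psi>' a * \<psi>' b"
      unfolding \<psi>'_eq[OF mem] \<psi>'_eq[OF j] \<psi>'_eq[OF k] eq partial_character_add[OF pc j k]
      by (simp add: power_add mult_ac)
  next
    fix a assume "a \<in> H'"
    then obtain k where k: "a - nat_scale k y \<in> H"
      unfolding H'_def by blast
    have "nat_scale ((CARD('g) - 1) * k) y + nat_scale k y = nat_scale (k * CARD('g)) y"
      by (simp flip: nat_scale_add) (metis One_nat_def Suc_pred add.commute mult.commute mult_Suc zero_less_card_finite)
    then have "nat_scale ((CARD('g) - 1) * k) y = - nat_scale k y"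
      by (simp add: nat_scale_mult nat_scale_card eq_neg_iff_add_eq_0)
    then have "- a - nat_scale ((CARD('g) - 1) * k) y = - (a - nat_scale k y)"
      by simp
    also have "\<dots> \<in> H"
      by (rule uminus_mem[OF k])
    finally show "- a \<in> H'"
      unfolding H'_def by (intro CollectI exI)
    show "cmod (\<psi>' a) = 1"
      unfolding \<psi>'_eq[OF k] norm_mult norm_power norm_w partial_character_norm[OF pc k] by simp
  qed
  moreover have "H \<subseteq> H'"
    unfolding H'_def by (auto intro!: exI[of _ 0])
  moreover have "y - nat_scale 1 y \<in> H"
    using zero_mem by simp
  then have "y \<in> H'" "\<psi>' y \<noteq> 1"
    using \<psi>'_eq[of y 1] w(2) partial_character_zero[OF pc] zero_mem
    unfolding H'_def by (auto intro!: exI[of _ 1])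
  moreover have "\<psi>' x = \<psi> x" if "x \<in> H" for x
    using \<psi>'_eq[of x 0] that by simp
  ultimately show thesis
    by (rule that)
qed

lemma character_separates:
  fixes x :: "'g::{finite, ab_group_add}"
  assumes "x \<noteq> 0"
  obtains \<xi> where "char_apply \<xi> x \<noteq> 1"
proof -
  define P where "P H \<longleftrightarrow> (\<exists>\<psi>. partial_character H \<psi> \<and> x \<in> H \<and> \<psi> x \<noteq> 1)" for H
  have "partial_character {0::'g} (\<lambda>_. 1)"
    by (simp add: partial_character_def)
  with assms obtain H0 where "P H0"
    unfolding P_def by (metis partial_character_extend singletonD)
  moreover have "card H < Suc CARD('g)" for H :: "'g set"
    by (simp add: card_mono less_Suc_eq_le)
  ultimately have "\<exists>H. P H \<and> (\<forall>H'. P H' \<longrightarrow> card H' \<le> card H)"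
    by (intro ex_has_greatest_nat) auto
  then obtain H where H: "P H" and max: "\<And>H'. P H' \<Longrightarrow> card H' \<le> card H"
    by blast
  obtain \<psi> where \<psi>: "partial_character H \<psi>" "x \<in> H" "\<psi> x \<noteq> 1"
    using H unfolding P_def by blast
  have "y \<in> H" for y
  proof (rule ccontr)
    assume y: "y \<notin> H"
    obtain H' \<psi>' where H': "partial_character H' \<psi>'" "H \<subseteq> H'" "y \<in> H'" "\<And>z. z \<in> H \<Longrightarrow> \<psi>' z = \<psi> z"
      using partial_character_extend[OF \<psi>(1) y] by metis
    then have "P H'"
      unfolding P_def using \<psi> by (intro exI[of _ \<psi>']) auto
    moreover have "card H < card H'"
      using H' y by (intro psubset_card_mono) auto
    ultimately show False
      using max by fastforce
  qed
  then have "\<psi> \<in> {\<xi>. (\<forall>x. cmod (\<xi> x) = 1) \<and> (\<forall>x y. \<xi> (x + y) = \<xi> x * \<xi> y)}"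
    using \<psi>(1) unfolding partial_character_def by blast
  then have "char_apply (Character \<psi>) x \<noteq> 1"
    using \<psi>(3) by (simp add: Character_inverse)
  then show thesis by (rule that)
qed

lemma char_apply_zero [simp]: "char_apply \<xi> 0 = 1"
  using char_apply_add[of \<xi> 0 0] char_apply_norm[of \<xi> 0] by auto

lemma char_apply_cnj: "cnj (char_apply \<xi> x) = char_apply \<xi> (- x)"
proof -
  have "char_apply \<xi> x * cnj (char_apply \<xi> x) = 1"
    using char_apply_norm[of \<xi> x] by (simp add: complex_norm_square[symmetric])
  moreover have "char_apply \<xi> x * char_apply \<xi> (- x) = 1"
    by (simp flip: char_apply_add)
  moreover have "char_apply \<xi> x \<noteq> 0"
    using char_apply_norm[of \<xi> x] by auto
  ultimately show ?thesis
    by (metis mult_left_cancel)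
qed

lemma char_apply_Character_mult:
  "char_apply (Character (\<lambda>x. char_apply \<xi> x * char_apply \<eta> x)) x = char_apply \<xi> x * char_apply \<eta> x"
  by (subst Character_inverse) (simp_all add: norm_mult char_apply_norm char_apply_add mult_ac)

text \<open>The two orthogonality relations: for sums over the group and for sums over its dual.\<close>

lemma sum_char_apply_group:
  fixes \<xi> \<eta> :: "'g::{finite, ab_group_add} character"
  shows "(\<Sum>x\<in>UNIV. char_apply \<xi> x * cnj (char_apply \<eta> x)) = (if \<xi> = \<eta> then of_nat CARD('g) else 0)"
proof (cases "\<xi> = \<eta>")
  case True
  then show ?thesis
    by (simp add: complex_norm_square[symmetric] char_apply_norm)
next
  case False
  then obtain a where a: "char_apply \<xi> a \<noteq> char_apply \<eta> a"
    by (metis char_apply_inject ext)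
  let ?f = "\<lambda>x. char_apply \<xi> x * cnj (char_apply \<eta> x)"
  have f_add: "?f (a + x) = ?f a * ?f x" for x
    by (simp add: char_apply_add mult_ac)
  have "?f a * (\<Sum>x\<in>UNIV. ?f x) = (\<Sum>x\<in>UNIV. ?f (a + x))"
    by (simp only: f_add sum_distrib_left)
  also have "\<dots> = (\<Sum>x\<in>UNIV. ?f x)"
    by (rule sum.reindex_bij_witness[of _ "\<lambda>y. y - a" "\<lambda>y. a + y"]) auto
  finally have "(?f a - 1) * (\<Sum>x\<in>UNIV. ?f x) = 0"
    by (simp add: algebra_simps)
  moreover have "?f a \<noteq> 1"
  proof
    assume "?f a = 1"
    then have "?f a * char_apply \<eta> a = char_apply \<eta> a" by simp
    moreover have "cnj (char_apply \<eta> a) * char_apply \<eta> a = 1"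
      using complex_norm_square[of "char_apply \<eta> a"] by (simp add: char_apply_norm mult.commute)
    ultimately show False using a by (simp add: mult.assoc)
  qed
  ultimately show ?thesis using False by simp
qed

lemma sum_char_apply_dual_nonzero:
  fixes x :: "'g::{finite, ab_group_add}"
  assumes "x \<noteq> 0"
  shows "(\<Sum>\<xi>\<in>UNIV. char_apply \<xi> x) = 0"
proof -
  obtain \<xi> where \<xi>: "char_apply \<xi> x \<noteq> 1"
    using assms by (rule character_separates)
  define m where "m \<eta> = Character (\<lambda>y. char_apply \<xi> y * char_apply \<eta> y)" for \<eta>
  have m: "char_apply (m \<eta>) y = char_apply \<xi> y * char_apply \<eta> y" for \<eta> y
    unfolding m_def by (rule char_apply_Character_mult)
  have "inj m"
  proof (rule injI)
    fix \<eta> \<zeta> assume eq: "m \<eta> = m \<zeta>"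
    have "char_apply \<eta> y = char_apply \<zeta> y" for y
    proof -
      have "char_apply \<xi> y * char_apply \<eta> y = char_apply \<xi> y * char_apply \<zeta> y"
        unfolding m[symmetric] eq ..
      moreover have "char_apply \<xi> y \<noteq> 0"
        using char_apply_norm[of \<xi> y] by auto
      ultimately show ?thesis by simp
    qed
    then show "\<eta> = \<zeta>" by (metis char_apply_inject ext)
  qed
  then have "bij m"
    by (simp add: bij_def finite_UNIV_inj_surj)
  then have "(\<Sum>\<eta>\<in>UNIV. char_apply \<eta> x) = (\<Sum>\<eta>\<in>UNIV. char_apply (m \<eta>) x)"
    by (rule sum.reindex_bij_betw[symmetric])
  also have "\<dots> = char_apply \<xi> x * (\<Sum>\<eta>\<in>UNIV. char_apply \<eta> x)"
    by (simp add: m sum_distrib_left)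
  finally show ?thesis using \<xi> by simp
qed

text \<open>
  Both sides are the sum of \<open>\<xi>(x)\<close> over all characters \<open>\<xi>\<close> and elements \<open>x\<close>, evaluated in the two
  possible orders.
\<close>

lemma card_character: "CARD('g::{finite, ab_group_add} character) = CARD('g)"
proof -
  define one where "one = Character (\<lambda>_::'g. 1)"
  have one: "char_apply one x = 1" for x
    by (simp add: one_def Character_inverse)
  have "of_nat CARD('g character) = (\<Sum>x\<in>UNIV. if x = (0::'g) then of_nat CARD('g character) else (0::complex))"
    by simp
  also have "\<dots> = (\<Sum>x::'g\<in>UNIV. \<Sum>\<xi>\<in>UNIV. char_apply \<xi> x)"
    by (intro sum.cong) (simp_all add: sum_char_apply_dual_nonzero)
  also have "\<dots> = (\<Sum>\<xi>\<in>UNIV. \<Sum>x::'g\<in>UNIV. char_apply \<xi> x * cnj (char_apply one x))"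
    by (subst sum.swap) (simp add: one)
  also have "\<dots> = of_nat CARD('g)"
    by (simp add: sum_char_apply_group)
  finally show ?thesis by (simp only: of_nat_eq_iff)
qed

lemma sum_char_apply_dual:
  fixes x y :: "'g::{finite, ab_group_add}"
  shows "(\<Sum>\<xi>\<in>UNIV. char_apply \<xi> x * cnj (char_apply \<xi> y)) = (if x = y then of_nat CARD('g) else 0)"
  using sum_char_apply_dual_nonzero[of "x - y"]
  by (simp add: char_apply_cnj card_character flip: char_apply_add)

section \<open>Separating and linearly independent families\<close>

lemma cinner_add_left: "cinner (f + h) k = cinner f k + cinner h k"
  by (simp add: cinner_def distrib_right sum.distrib)

lemma cinner_diff_left: "cinner (f - h) k = cinner f k - cinner h k"
  by (simp add: cinner_def left_diff_distrib sum_subtractf)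

lemma cinner_scaleR_left: "cinner (r *\<^sub>R f) k = r *\<^sub>R cinner f k"
  by (simp add: cinner_def scaleR_sum_right)

lemma cinner_zero_left [simp]: "cinner 0 k = 0"
  by (simp add: cinner_def)

text \<open>
  No nonzero vector is orthogonal to all members.  Equivalently, as the dimension is finite, the
  members span the space.
\<close>

definition separating :: "'k set \<Rightarrow> ('k \<Rightarrow> complex ^ 'n) \<Rightarrow> bool" where
  "separating K \<phi> \<longleftrightarrow> (\<forall>f. (\<forall>k\<in>K. cinner f (\<phi> k) = 0) \<longrightarrow> f = 0)"

text \<open>
  Linear independence of an indexed family, as a condition on the coefficients.  A repeated vector
  makes the family dependent.
\<close>

definition family_independent :: "'k set \<Rightarrow> ('k \<Rightarrow> complex ^ 'n) \<Rightarrow> bool" where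
  "family_independent S \<phi> \<longleftrightarrow>
     (\<forall>c. (\<Sum>k\<in>S. c k *s \<phi> k) = 0 \<longrightarrow> (\<forall>k\<in>S. c k = 0))"

lemma family_independentD:
  "family_independent S \<phi> \<Longrightarrow> (\<Sum>k\<in>S. c k *s \<phi> k) = 0 \<Longrightarrow> k \<in> S \<Longrightarrow> c k = 0"
  unfolding family_independent_def by blast

lemma separating_mono: "separating K \<phi> \<Longrightarrow> K \<subseteq> L \<Longrightarrow> separating L \<phi>"
  unfolding separating_def by blast

lemma family_independent_subset:
  assumes indep: "family_independent S \<phi>" and sub: "T \<subseteq> S" and fin: "finite S"
  shows "family_independent T \<phi>"
  unfolding family_independent_def
proof (intro allI impI ballI)
  fix c k assume 0: "(\<Sum>k\<in>T. c k *s \<phi> k) = 0" and "k \<in> T"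
  let ?c = "\<lambda>k. if k \<in> T then c k else 0"
  have "(\<Sum>k\<in>S. ?c k *s \<phi> k) = (\<Sum>k\<in>T. c k *s \<phi> k)"
    using sub fin by (intro sum.mono_neutral_cong_right) auto
  then have "?c k = 0"
    using 0 sub \<open>k \<in> T\<close> by (intro family_independentD[OF indep, of ?c]) auto
  then show "c k = 0"
    using \<open>k \<in> T\<close> by simp
qed

lemma family_independent_iff:
  assumes "finite S"
  shows "family_independent S \<phi> \<longleftrightarrow> inj_on \<phi> S \<and> vec.independent (\<phi> ` S)"
proof
  assume indep: "family_independent S \<phi>"
  have inj: "inj_on \<phi> S"
  proof (rule inj_onI, rule ccontr)
    fix a b assume ab: "a \<in> S" "b \<in> S" "\<phi> a = \<phi> b" "a \<noteq> b"
    let ?c = "\<lambda>k. if k = a then 1 else if k = b then - 1 else (0::complex)"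
    have "(\<Sum>k\<in>S. ?c k *s \<phi> k) = (\<Sum>k\<in>{a, b}. ?c k *s \<phi> k)"
      using ab assms by (intro sum.mono_neutral_right) auto
    also have "\<dots> = 0"
      using ab by (simp add: vec_eq_iff)
    finally have "?c a = 0"
      using ab(1) by (rule family_independentD[OF indep, of ?c])
    then show False by simp
  qed
  have "c v = 0" if c: "(\<Sum>v\<in>\<phi> ` S. c v *s v) = 0" and v: "v \<in> \<phi> ` S" for c v
  proof -
    have "(\<Sum>k\<in>S. c (\<phi> k) *s \<phi> k) = 0"
      using c by (simp add: sum.reindex[OF inj])
    then show ?thesis
      using v family_independentD[OF indep, of "\<lambda>k. c (\<phi> k)"] by auto
  qed
  with inj show "inj_on \<phi> S \<and> vec.independent (\<phi> ` S)"
    using assms by (auto simp: vec.independent_explicit)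
next
  assume R: "inj_on \<phi> S \<and> vec.independent (\<phi> ` S)"
  then have inj: "inj_on \<phi> S" and indep: "vec.independent (\<phi> ` S)" by auto
  show "family_independent S \<phi>"
    unfolding family_independent_def
  proof (intro allI impI ballI)
    fix c k assume 0: "(\<Sum>k\<in>S. c k *s \<phi> k) = 0" and k: "k \<in> S"
    have "(\<Sum>v\<in>\<phi> ` S. c (the_inv_into S \<phi> v) *s v) = 0"
      using 0 by (simp add: sum.reindex[OF inj] the_inv_into_f_f[OF inj] cong: sum.cong)
    moreover have "\<forall>d. (\<Sum>v\<in>\<phi> ` S. d v *s v) = 0 \<longrightarrow> (\<forall>v\<in>\<phi> ` S. d v = 0)"
      using indep unfolding vec.independent_explicit by blast
    ultimately have "c (the_inv_into S \<phi> (\<phi> k)) = 0"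
      using k by (elim allE[of _ "\<lambda>v. c (the_inv_into S \<phi> v)"]) blast
    then show "c k = 0"
      using k by (simp add: the_inv_into_f_f[OF inj])
  qed
qed

lemma family_independent_card_le:
  fixes \<phi> :: "'k \<Rightarrow> complex ^ 'n"
  assumes "finite S" "family_independent S \<phi>"
  shows "card S \<le> CARD('n)"
proof -
  have "card (\<phi> ` S) \<le> CARD('n)"
    using vec.independent_card_le_dim[of "\<phi> ` S" UNIV] assms
    by (simp add: family_independent_iff vec.dim_UNIV card_cart_basis)
  then show ?thesis
    using assms by (simp add: family_independent_iff card_image)
qed

lemma general_position_iff:
  fixes \<phi> :: "'k::finite \<Rightarrow> complex ^ 'n"
  assumes "CARD('n) \<le> CARD('k)"
  shows "general_position UNIV \<phi> \<longleftrightarrow> (\<forall>S. card S = CARD('n) \<longrightarrow> family_independent S \<phi>)"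
proof -
  have "family_independent T \<phi>"
    if "\<forall>S. card S = CARD('n) \<longrightarrow> family_independent S \<phi>" and le: "card T \<le> CARD('n)" for T
  proof -
    obtain S where "T \<subseteq> S" "card S = CARD('n)"
      using exists_subset_between[of T "CARD('n)" UNIV] le assms by auto
    with that(1) show ?thesis
      by (blast intro: family_independent_subset finite)
  qed
  then show ?thesis
    unfolding general_position_def by (auto simp flip: family_independent_iff)
qed

text \<open>
  Both sides express invertibility of the square matrix whose rows are the given vectors: its kernel
  consists of the conjugates of the vectors orthogonal to all of them.
\<close>

lemma separating_iff_family_independent:
  fixes \<phi> :: "'k \<Rightarrow> complex ^ 'n"
  assumes card: "card S = CARD('n)"
  shows "separating S \<phi> \<longleftrightarrow> family_independent S \<phi>"
proof -
  have fin: "finite S"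
    using card by (intro card_ge_0_finite) simp
  obtain \<rho> :: "'n \<Rightarrow> 'k" where \<rho>: "bij_betw \<rho> UNIV S"
    using finite_same_card_bij[of "UNIV :: 'n set" S] fin card by auto
  have inj: "inj \<rho>" and ran: "range \<rho> = S"
    using \<rho> by (auto simp: bij_betw_def)
  define M :: "complex ^ 'n ^ 'n" where "M = (\<chi> i. \<phi> (\<rho> i))"
  have mult: "(M *v (\<chi> j. cnj (f $ j))) $ i = cnj (cinner f (\<phi> (\<rho> i)))" for f i
    by (simp add: M_def matrix_vector_mult_def cinner_def mult.commute)
  have "separating S \<phi> \<longleftrightarrow> (\<forall>f. (\<forall>i. cinner f (\<phi> (\<rho> i)) = 0) \<longrightarrow> f = 0)"
    unfolding separating_def by (simp flip: ran)
  also have "\<dots> \<longleftrightarrow> (\<forall>f. M *v (\<chi> j. cnj (f $ j)) = 0 \<longrightarrow> (\<chi> j. cnj (f $ j)) = 0)"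
    by (simp add: vec_eq_iff[where y = 0] mult)
  also have "\<dots> \<longleftrightarrow> (\<forall>f. M *v f = 0 \<longrightarrow> f = 0)"
  proof -
    have "\<exists>f. h = (\<chi> j. cnj (f $ j))" for h :: "complex ^ 'n"
      by (rule exI[of _ "\<chi> j. cnj (h $ j)"]) (simp add: vec_eq_iff)
    then show ?thesis by metis
  qed
  also have "\<dots> \<longleftrightarrow> (\<exists>B. M ** B = mat 1)"
    by (simp only: matrix_left_invertible_ker[symmetric] matrix_left_right_inverse)
  also have "\<dots> \<longleftrightarrow> (\<forall>c. (\<Sum>i\<in>UNIV. c i *s \<phi> (\<rho> i)) = 0 \<longrightarrow> (\<forall>i. c i = 0))"
    by (simp add: matrix_right_invertible_independent_rows M_def row_def)
  also have "\<dots> \<longleftrightarrow> family_independent S \<phi>"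
  proof
    assume L: "\<forall>c. (\<Sum>i\<in>UNIV. c i *s \<phi> (\<rho> i)) = 0 \<longrightarrow> (\<forall>i. c i = 0)"
    show "family_independent S \<phi>"
      unfolding family_independent_def
    proof (intro allI impI)
      fix c assume "(\<Sum>k\<in>S. c k *s \<phi> k) = 0"
      then have "(\<Sum>i\<in>UNIV. c (\<rho> i) *s \<phi> (\<rho> i)) = 0"
        by (simp add: sum.reindex_bij_betw[OF \<rho>, of "\<lambda>k. c k *s \<phi> k"])
      then have "\<forall>i. c (\<rho> i) = 0"
        using L[rule_format, of "\<lambda>i. c (\<rho> i)"] by blast
      then show "\<forall>k\<in>S. c k = 0" by (auto simp flip: ran)
    qed
  next
    assume R: "family_independent S \<phi>"
    show "\<forall>c. (\<Sum>i\<in>UNIV. c i *s \<phi> (\<rho> i)) = 0 \<longrightarrow> (\<forall>i. c i = 0)"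
    proof (intro allI impI)
      fix c i assume 0: "(\<Sum>i\<in>UNIV. c i *s \<phi> (\<rho> i)) = 0"
      have "(\<Sum>k\<in>S. c (inv \<rho> k) *s \<phi> k) = (\<Sum>i\<in>UNIV. c (inv \<rho> (\<rho> i)) *s \<phi> (\<rho> i))"
        by (rule sum.reindex_bij_betw[OF \<rho>, symmetric])
      also have "\<dots> = 0"
        using 0 inj by simp
      finally have "c (inv \<rho> (\<rho> i)) = 0"
        using ran by (intro family_independentD[OF R, of "\<lambda>k. c (inv \<rho> k)"]) auto
      then show "c i = 0" using inj by simp
    qed
  qed
  finally show ?thesis .
qed

section \<open>Frames and minors\<close>

text \<open>
  A separating family has an injective analysis operator, and an injective linear map between
  finite-dimensional spaces is bounded below.
\<close>

lemma is_frame_iff_separating: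
  fixes \<phi> :: "'k::finite \<Rightarrow> complex ^ 'n"
  shows "is_frame K \<phi> \<longleftrightarrow> separating K \<phi>"
proof
  assume "is_frame K \<phi>"
  then obtain A B where A: "A > 0" "\<And>f. A * (norm f)\<^sup>2 \<le> (\<Sum>k\<in>K. (cmod (cinner f (\<phi> k)))\<^sup>2)"
    unfolding is_frame_def frame_bounds_def by blast
  show "separating K \<phi>"
    unfolding separating_def
  proof (intro allI impI)
    fix f assume "\<forall>k\<in>K. cinner f (\<phi> k) = 0"
    then have "A * (norm f)\<^sup>2 \<le> 0" using A(2)[of f] by simp
    then show "f = 0" using A(1) by (simp add: mult_le_0_iff)
  qed
next
  assume sep: "separating K \<phi>"
  \<comment> \<open>The analysis operator of the subfamily, padded with zeros so that its codomain is a type.\<close>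
  define T :: "complex ^ 'n \<Rightarrow> complex ^ 'k" where
    "T f = (\<chi> k. if k \<in> K then cinner f (\<phi> k) else 0)" for f
  have norm_T: "(norm (T f))\<^sup>2 = (\<Sum>k\<in>K. (cmod (cinner f (\<phi> k)))\<^sup>2)" for f
    by (simp add: T_def norm_vec_def L2_set_def sum_nonneg if_distrib[of cmod]
        if_distrib[of "\<lambda>x. x\<^sup>2"] sum.If_cases cong: if_cong)
  have lin: "linear T"
    by (rule linearI) (simp_all add: T_def vec_eq_iff cinner_add_left cinner_scaleR_left)
  have "inj T"
    unfolding linear_injective_0[OF lin]
    using sep by (auto simp: T_def separating_def vec_eq_iff)
  obtain a where a: "a > 0" "\<And>f. a * norm f \<le> norm (T f)"
    using linear_inj_bounded_below_pos[OF lin \<open>inj T\<close>] by blast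
  obtain b where b: "b > 0" "\<And>f. norm (T f) \<le> b * norm f"
    using linear_bounded_pos[OF lin] by blast
  have "frame_bounds (a\<^sup>2) (b\<^sup>2) K \<phi>"
    unfolding frame_bounds_def norm_T[symmetric]
    using a b by (auto simp flip: power_mult_distrib intro!: power_mono)
  then show "is_frame K \<phi>"
    unfolding is_frame_def by blast
qed

lemma maximally_robust_iff:
  fixes \<phi> :: "'k::finite \<Rightarrow> complex ^ 'n"
  assumes "CARD('n) \<le> CARD('k)"
  shows "maximally_robust UNIV \<phi> \<longleftrightarrow> (\<forall>S. card S = CARD('n) \<longrightarrow> separating S \<phi>)"
proof
  assume robust: "maximally_robust UNIV \<phi>"
  show "\<forall>S. card S = CARD('n) \<longrightarrow> separating S \<phi>"
  proof (intro allI impI)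
    fix S :: "'k set" assume S: "card S = CARD('n)"
    have "card (UNIV - S) + CARD('n) \<le> CARD('k)"
      using S assms by (simp add: card_Diff_subset)
    then have "is_frame (UNIV - (UNIV - S)) \<phi>"
      using robust unfolding maximally_robust_def by blast
    then show "separating S \<phi>"
      by (simp add: is_frame_iff_separating double_diff)
  qed
next
  assume all: "\<forall>S. card S = CARD('n) \<longrightarrow> separating S \<phi>"
  have sep: "separating K \<phi>" if large: "CARD('n) \<le> card K" for K
  proof -
    obtain S where "S \<subseteq> K" "card S = CARD('n)"
      using obtain_subset_with_card_n[OF large] by metis
    then show ?thesis
      using all separating_mono by blast
  qed
  have "separating (UNIV - L) \<phi>" if "card L + CARD('n) \<le> CARD('k)" for L
    using that by (intro sep) (simp add: card_Diff_subset)
  then show "maximally_robust UNIV \<phi>"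
    unfolding maximally_robust_def is_frame_iff_separating using sep[of UNIV] assms by simp
qed

text \<open>As the order of the minors is the number of columns, choosing columns only permutes them.\<close>

lemma minors_nonzero_iff:
  fixes A :: "complex ^ 'n ^ 'm::finite"
  shows "(\<forall>(\<rho> :: 'n \<Rightarrow> 'm) (\<kappa> :: 'n \<Rightarrow> 'n). inj \<rho> \<and> inj \<kappa> \<longrightarrow> minor \<rho> \<kappa> A \<noteq> 0) \<longleftrightarrow>
    (\<forall>S. card S = CARD('n) \<longrightarrow> (\<forall>f. (\<forall>k\<in>S. (A *v f) $ k = 0) \<longrightarrow> f = 0))"
proof -
  have minor: "minor \<rho> \<kappa> A \<noteq> 0 \<longleftrightarrow> (\<forall>f. (\<forall>i. (A *v f) $ \<rho> i = 0) \<longrightarrow> f = 0)"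
    if "inj \<kappa>" for \<rho> :: "'n \<Rightarrow> 'm" and \<kappa> :: "'n \<Rightarrow> 'n"
  proof -
    have "bij \<kappa>"
      using that by (simp add: bij_def finite_UNIV_inj_surj)
    let ?M = "\<chi> i j. A $ \<rho> i $ \<kappa> j"
    have mult: "(?M *v (\<chi> j. f $ \<kappa> j)) $ i = (A *v f) $ \<rho> i" for f i
      using sum.reindex_bij_betw[OF \<open>bij \<kappa>\<close>, of "\<lambda>j. A $ \<rho> i $ j * f $ j"]
      by (simp add: matrix_vector_mult_def)
    have surj: "\<exists>f. h = (\<chi> j. f $ \<kappa> j)" for h :: "complex ^ 'n"
      by (rule exI[of _ "\<chi> j. h $ inv \<kappa> j"]) (simp add: vec_eq_iff that)
    have zero: "(\<chi> j. f $ \<kappa> j) = 0 \<longleftrightarrow> f = 0" for f :: "complex ^ 'n"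
      using \<open>bij \<kappa>\<close> by (simp add: vec_eq_iff) (metis bij_pointE)
    have "minor \<rho> \<kappa> A \<noteq> 0 \<longleftrightarrow> (\<forall>h. ?M *v h = 0 \<longrightarrow> h = 0)"
      by (simp only: minor_def invertible_det_nz[symmetric] invertible_left_inverse matrix_left_invertible_ker)
    also have "\<dots> \<longleftrightarrow> (\<forall>f. ?M *v (\<chi> j. f $ \<kappa> j) = 0 \<longrightarrow> (\<chi> j. f $ \<kappa> j) = 0)"
      using surj by metis
    also have "\<dots> \<longleftrightarrow> (\<forall>f. (\<forall>i. (A *v f) $ \<rho> i = 0) \<longrightarrow> f = 0)"
      by (simp only: zero vec_eq_iff[where y = "0 :: complex ^ 'n" and x = "_ *v _"] mult zero_index)
    finally show ?thesis .
  qed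
  show ?thesis
  proof (intro iffI allI impI)
    fix S :: "'m set" and f :: "complex ^ 'n"
    assume L: "\<forall>(\<rho> :: 'n \<Rightarrow> 'm) (\<kappa> :: 'n \<Rightarrow> 'n). inj \<rho> \<and> inj \<kappa> \<longrightarrow> minor \<rho> \<kappa> A \<noteq> 0"
      and S: "card S = CARD('n)" and f: "\<forall>k\<in>S. (A *v f) $ k = 0"
    obtain \<rho> :: "'n \<Rightarrow> 'm" where "bij_betw \<rho> UNIV S"
      using finite_same_card_bij[of "UNIV :: 'n set" S] S by auto
    then have \<rho>: "inj \<rho>" "range \<rho> = S"
      by (auto simp: bij_betw_def)
    then have "minor \<rho> id A \<noteq> 0"
      using L by simp
    moreover have "\<forall>i. (A *v f) $ \<rho> i = 0"
      using f \<rho>(2) by blast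
    ultimately show "f = 0"
      unfolding minor[of id \<rho>, OF inj_on_id] by blast
  next
    fix \<rho> :: "'n \<Rightarrow> 'm" and \<kappa> :: "'n \<Rightarrow> 'n"
    assume R: "\<forall>S. card S = CARD('n) \<longrightarrow> (\<forall>f. (\<forall>k\<in>S. (A *v f) $ k = 0) \<longrightarrow> f = 0)"
      and inj: "inj \<rho> \<and> inj \<kappa>"
    have "card (range \<rho>) = CARD('n)"
      using inj by (simp add: card_image)
    with R show "minor \<rho> \<kappa> A \<noteq> 0"
      unfolding minor[OF conjunct2[OF inj]] by blast
  qed
qed

section \<open>The Gabor system\<close>

lemma norm_tf_shift: "norm (tf_shift l g) = norm g"
proof -
  have "(\<Sum>y\<in>UNIV. (cmod (g $ (y - fst l)))\<^sup>2) = (\<Sum>y\<in>UNIV. (cmod (g $ y))\<^sup>2)"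
    by (rule sum.reindex_bij_witness[of _ "\<lambda>y. y + fst l" "\<lambda>y. y - fst l"]) auto
  then show ?thesis
    by (simp add: tf_shift_def norm_vec_def L2_set_def norm_mult char_apply_norm)
qed

text \<open>
  For fixed translation \<open>x\<close> the sum over the characters is, by Parseval's identity, a multiple of the
  squared norm of \<open>y \<mapsto> f(y) * cnj (g(y - x))\<close>; the sum over \<open>x\<close> then splits as a product.
\<close>

lemma sum_cmod_stft:
  fixes f g :: "complex ^ ('g::{finite, ab_group_add})"
  shows "(\<Sum>l\<in>UNIV. (cmod (cinner f (tf_shift l g)))\<^sup>2) = of_nat CARD('g) * (norm g)\<^sup>2 * (norm f)\<^sup>2"
proof -
  let ?F = "\<lambda>x y. f $ y * cnj (g $ (y - x))"
  have norm_sum: "of_real ((norm v)\<^sup>2) = (\<Sum>y\<in>UNIV. v $ y * cnj (v $ y))" for v :: "'g signal"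
    using cinner_self[of v] by (simp add: cinner_def)
  have parseval: "(\<Sum>\<xi>\<in>UNIV. of_real ((cmod (cinner f (tf_shift (x, \<xi>) g)))\<^sup>2)) =
      of_nat CARD('g) * (\<Sum>y\<in>UNIV. ?F x y * cnj (?F x y))" for x
  proof -
    have "(\<Sum>\<xi>\<in>UNIV. of_real ((cmod (cinner f (tf_shift (x, \<xi>) g)))\<^sup>2)) =
        (\<Sum>\<xi>\<in>UNIV. \<Sum>y\<in>UNIV. \<Sum>z\<in>UNIV. (?F x y * cnj (?F x z)) *
          (char_apply \<xi> z * cnj (char_apply \<xi> y)))"
      unfolding complex_norm_square cinner_def cnj_sum sum_product by (simp add: tf_shift_def mult_ac)
    also have "\<dots> = (\<Sum>y\<in>UNIV. \<Sum>z\<in>UNIV. \<Sum>\<xi>\<in>UNIV. (?F x y * cnj (?F x z)) *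
          (char_apply \<xi> z * cnj (char_apply \<xi> y)))"
      by (subst sum.swap, intro sum.cong refl, rule sum.swap)
    also have "\<dots> = (\<Sum>y\<in>UNIV. \<Sum>z\<in>UNIV. (?F x y * cnj (?F x z)) *
          (if z = y then of_nat CARD('g) else 0))"
      by (simp only: sum_distrib_left[symmetric] sum_char_apply_dual)
    also have "\<dots> = of_nat CARD('g) * (\<Sum>y\<in>UNIV. ?F x y * cnj (?F x y))"
      by (simp add: if_distrib[of "\<lambda>t. _ * t"] sum_distrib_left mult_ac cong: if_cong)
    finally show ?thesis .
  qed
  have shift: "(\<Sum>x\<in>UNIV. g $ (y - x) * cnj (g $ (y - x))) = (\<Sum>x\<in>UNIV. g $ x * cnj (g $ x))" for y
    by (rule sum.reindex_bij_witness[of _ "\<lambda>x. y - x" "\<lambda>x. y - x"]) auto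
  have "complex_of_real (\<Sum>l\<in>UNIV. (cmod (cinner f (tf_shift l g)))\<^sup>2) =
      (\<Sum>x\<in>UNIV. \<Sum>\<xi>\<in>UNIV. of_real ((cmod (cinner f (tf_shift (x, \<xi>) g)))\<^sup>2))"
    by (simp add: sum.cartesian_product case_prod_unfold flip: UNIV_Times_UNIV)
  also have "\<dots> = of_nat CARD('g) * (\<Sum>x\<in>UNIV. \<Sum>y\<in>UNIV. ?F x y * cnj (?F x y))"
    by (simp only: parseval sum_distrib_left)
  also have "(\<Sum>x\<in>UNIV. \<Sum>y\<in>UNIV. ?F x y * cnj (?F x y)) =
      (\<Sum>y\<in>UNIV. f $ y * cnj (f $ y) * (\<Sum>x\<in>UNIV. g $ (y - x) * cnj (g $ (y - x))))"
    by (subst sum.swap) (simp add: sum_distrib_left mult_ac)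
  also have "\<dots> = of_real ((norm f)\<^sup>2) * of_real ((norm g)\<^sup>2)"
    by (simp only: shift norm_sum sum_distrib_right)
  also have "of_nat CARD('g) * \<dots> = complex_of_real (of_nat CARD('g) * (norm g)\<^sup>2 * (norm f)\<^sup>2)"
    by simp
  finally show ?thesis
    by (simp only: of_real_eq_iff)
qed

lemma tight_frame_tf_shift:
  assumes "g \<noteq> 0"
  shows "tight_frame UNIV (\<lambda>l. tf_shift l g)"
proof -
  have "frame_bounds (of_nat CARD('a) * (norm g)\<^sup>2) (of_nat CARD('a) * (norm g)\<^sup>2) UNIV (\<lambda>l. tf_shift l g)"
    using assms by (simp add: frame_bounds_def sum_cmod_stft)
  then show ?thesis
    unfolding tight_frame_def by blast
qed

text \<open>
  Applied to a point mass at \<open>y - x\<close> and evaluated at \<open>y\<close>, a linear combination of shifts retains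
  the terms with translation part \<open>x\<close> only; orthogonality of the characters then isolates each
  coefficient.
\<close>

lemma tf_shift_independent:
  fixes c :: "'g::{finite, ab_group_add} \<times> 'g character \<Rightarrow> complex"
  assumes "(\<lambda>f. \<Sum>l\<in>\<Lambda>. c l *s tf_shift l f) = (\<lambda>f. 0)" and "k \<in> \<Lambda>"
  shows "c k = 0"
proof -
  obtain x \<eta> where k: "k = (x, \<eta>)" by (cases k)
  define d where "d l = (if l \<in> \<Lambda> then c l else 0)" for l
  have eval: "(\<Sum>\<xi>\<in>UNIV. d (x, \<xi>) * char_apply \<xi> y) = 0" for y
  proof -
    let ?\<delta> = "\<chi> z. if z = y - x then 1 else (0 :: complex)"
    have shift: "tf_shift (u, \<xi>) ?\<delta> $ y = (if u = x then char_apply \<xi> y else 0)" for u \<xi>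
      by (simp add: tf_shift_def)
    have "0 = (\<Sum>l\<in>\<Lambda>. c l *s tf_shift l ?\<delta>) $ y"
      using fun_cong[OF assms(1), of ?\<delta>] by simp
    also have "\<dots> = (\<Sum>l\<in>UNIV. d l * tf_shift l ?\<delta> $ y)"
      by (simp add: d_def if_distrib[of "\<lambda>t. t * _"] sum.If_cases cong: if_cong)
    also have "\<dots> = (\<Sum>u\<in>UNIV. \<Sum>\<xi>\<in>UNIV. d (u, \<xi>) * tf_shift (u, \<xi>) ?\<delta> $ y)"
      by (simp add: sum.cartesian_product case_prod_unfold)
    also have "\<dots> = (\<Sum>u\<in>UNIV. if u = x then \<Sum>\<xi>\<in>UNIV. d (x, \<xi>) * char_apply \<xi> y else 0)"
      unfolding shift by (intro sum.cong) auto
    also have "\<dots> = (\<Sum>\<xi>\<in>UNIV. d (x, \<xi>) * char_apply \<xi> y)"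
      by simp
    finally show ?thesis by simp
  qed
  have "0 = (\<Sum>y\<in>UNIV. (\<Sum>\<xi>\<in>UNIV. d (x, \<xi>) * char_apply \<xi> y) * cnj (char_apply \<eta> y))"
    by (simp add: eval)
  also have "\<dots> = (\<Sum>\<xi>\<in>UNIV. d (x, \<xi>) * (\<Sum>y\<in>UNIV. char_apply \<xi> y * cnj (char_apply \<eta> y)))"
    by (simp add: sum_distrib_left sum_distrib_right mult.assoc) (rule sum.swap)
  also have "\<dots> = d (x, \<eta>) * of_nat CARD('g)"
    by (simp add: sum_char_apply_group if_distrib[of "\<lambda>t. _ * t"] cong: if_cong)
  finally show ?thesis
    using assms(2) by (simp add: d_def k)
qed

lemma identifiable_iff_family_independent:
  fixes g :: "complex ^ ('g::{finite, ab_group_add})"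
  shows "identifiable_by (operator_space \<Lambda>) g \<longleftrightarrow> family_independent \<Lambda> (\<lambda>l. tf_shift l g)"
proof
  assume inj: "identifiable_by (operator_space \<Lambda>) g"
  show "family_independent \<Lambda> (\<lambda>l. tf_shift l g)"
    unfolding family_independent_def
  proof (intro allI impI)
    fix c :: "'g \<times> 'g character \<Rightarrow> complex"
    assume 0: "(\<Sum>l\<in>\<Lambda>. c l *s tf_shift l g) = 0"
    have "(\<lambda>f. \<Sum>l\<in>\<Lambda>. c l *s tf_shift l f) \<in> operator_space \<Lambda>"
      unfolding operator_space_def by blast
    moreover have "(\<lambda>f. 0) \<in> operator_space \<Lambda>"
      unfolding operator_space_def by (auto intro!: exI[of _ "\<lambda>_. 0"])
    ultimately have "(\<lambda>f. \<Sum>l\<in>\<Lambda>. c l *s tf_shift l f) = (\<lambda>f. 0)"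
      using inj 0 unfolding identifiable_by_def by (intro inj_onD[of "\<lambda>H. H g"])
    then show "\<forall>l\<in>\<Lambda>. c l = 0"
      using tf_shift_independent by blast
  qed
next
  assume indep: "family_independent \<Lambda> (\<lambda>l. tf_shift l g)"
  show "identifiable_by (operator_space \<Lambda>) g"
    unfolding identifiable_by_def
  proof (rule inj_onI)
    fix H H' assume "H \<in> operator_space \<Lambda>" "H' \<in> operator_space \<Lambda>" and eq: "H g = H' g"
    then obtain c c' where H: "H = (\<lambda>f. \<Sum>l\<in>\<Lambda>. c l *s tf_shift l f)"
      and H': "H' = (\<lambda>f. \<Sum>l\<in>\<Lambda>. c' l *s tf_shift l f)"
      unfolding operator_space_def by blast
    have "(\<Sum>l\<in>\<Lambda>. (c l - c' l) *s tf_shift l g) = 0"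
      using eq by (simp add: H H' vector_sub_rdistrib sum_subtractf)
    then have "\<forall>l\<in>\<Lambda>. c l - c' l = 0"
      using family_independentD[OF indep, of "\<lambda>l. c l - c' l"] by blast
    then show "H = H'"
      unfolding H H' by (intro ext sum.cong) auto
  qed
qed

lemma stft_diff: "stft g (f - h) = stft g f - stft g h"
  by (simp add: stft_def vec_eq_iff cinner_diff_left)

lemma l0_norm_ge_iff:
  fixes F :: "complex ^ 'k::finite"
  assumes "0 < n" "n \<le> CARD('k)"
  shows "CARD('k) - n + 1 \<le> l0_norm F \<longleftrightarrow> \<not> (\<exists>S. card S = n \<and> (\<forall>k\<in>S. F $ k = 0))"
proof -
  let ?Z = "{k. F $ k = 0}"
  have "{k. F $ k \<noteq> 0} = UNIV - ?Z" by auto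
  then have "l0_norm F = CARD('k) - card ?Z"
    by (simp add: l0_norm_def card_Diff_subset)
  moreover have "card ?Z \<le> CARD('k)"
    by (simp add: card_mono)
  ultimately have "CARD('k) - n + 1 \<le> l0_norm F \<longleftrightarrow> \<not> n \<le> card ?Z"
    using assms by linarith
  also have "n \<le> card ?Z \<longleftrightarrow> (\<exists>S. card S = n \<and> S \<subseteq> ?Z)"
    by (metis obtain_subset_with_card_n card_mono finite)
  finally show ?thesis by (auto simp: subset_iff)
qed

section \<open>The equivalence\<close>

theorem theorem5p4:
  fixes g :: "complex ^ ('g::{finite, ab_group_add})"
  assumes "g \<noteq> 0"
  shows "all_equivalent
    [\<forall>(\<rho> :: 'g \<Rightarrow> 'g \<times> 'g character) (\<kappa> :: 'g \<Rightarrow> 'g).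
        inj \<rho> \<and> inj \<kappa> \<longrightarrow> minor \<rho> \<kappa> (gabor_matrix g) \<noteq> 0,
     general_position UNIV (\<lambda>l. tf_shift l g),
     equal_norm UNIV (\<lambda>l. tf_shift l g) \<and>
       tight_frame UNIV (\<lambda>l. tf_shift l g) \<and>
       maximally_robust UNIV (\<lambda>l. tf_shift l g),
     \<forall>f. f \<noteq> 0 \<longrightarrow> l0_norm (stft g f) \<ge> CARD('g)\<^sup>2 - CARD('g) + 1,
     \<forall>f h. \<forall>\<Lambda> :: ('g \<times> 'g character) set.
        card \<Lambda> = CARD('g) \<and> (\<forall>l\<in>\<Lambda>. stft g f $ l = stft g h $ l) \<longrightarrow>
        stft g f = stft g h \<and> f = h,
     \<forall>\<Lambda> :: ('g \<times> 'g character) set.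
        identifiable_by (operator_space \<Lambda>) g \<longleftrightarrow> card \<Lambda> \<le> CARD('g)]"
    (is "all_equivalent [?P1, ?P2, ?P3, ?P4, ?P5, ?P6]")
proof -
  let ?\<phi> = "\<lambda>l. tf_shift l g"
  \<comment> \<open>The condition to which the first five are reduced.\<close>
  define C where "C \<longleftrightarrow> (\<forall>S. card S = CARD('g) \<longrightarrow> separating S ?\<phi>)"
  have C: "C \<longleftrightarrow> (\<forall>S. card S = CARD('g) \<longrightarrow> (\<forall>f. (\<forall>l\<in>S. stft g f $ l = 0) \<longrightarrow> f = 0))"
    by (simp add: C_def separating_def stft_def)
  have card: "CARD('g \<times> 'g character) = CARD('g)\<^sup>2"
    by (simp add: card_character power2_eq_square)
  then have le: "CARD('g) \<le> CARD('g \<times> 'g character)"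
    by (simp add: power2_nat_le_imp_le)
  have 1: "?P1 \<longleftrightarrow> C"
    unfolding minors_nonzero_iff C gabor_matrix_mult ..
  have 2: "?P2 \<longleftrightarrow> C"
    unfolding general_position_iff[OF le] C_def by (simp add: separating_iff_family_independent)
  have "equal_norm UNIV ?\<phi>"
    unfolding equal_norm_def norm_tf_shift using assms by (intro exI[of _ "norm g"]) simp
  then have 3: "?P3 \<longleftrightarrow> C"
    using tight_frame_tf_shift[OF assms] by (simp add: maximally_robust_iff[OF le] C_def)
  have 4: "?P4 \<longleftrightarrow> C"
    unfolding C card[symmetric] l0_norm_ge_iff[OF zero_less_card_finite le] by blast
  have 5: "?P5 \<longleftrightarrow> C"
  proof
    assume P5: ?P5
    show C
      unfolding C
    proof (intro allI impI)
      fix S and f :: "'g signal"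
      assume S: "card S = CARD('g)" and f: "\<forall>l\<in>S. stft g f $ l = 0"
      have "stft g 0 $ l = 0" for l
        by (simp add: stft_def)
      with S f P5 show "f = 0" by (metis (no_types, lifting))
    qed
  next
    assume C
    show ?P5
    proof (intro allI impI)
      fix f h :: "'g signal" and \<Lambda> :: "('g \<times> 'g character) set"
      assume \<Lambda>: "card \<Lambda> = CARD('g) \<and> (\<forall>l\<in>\<Lambda>. stft g f $ l = stft g h $ l)"
      then have "\<forall>l\<in>\<Lambda>. stft g (f - h) $ l = 0"
        by (simp add: stft_diff)
      with \<Lambda> \<open>C\<close> have "f - h = 0"
        unfolding C by blast
      then show "stft g f = stft g h \<and> f = h" by simp
    qed
  qed
  have 6: "?P6 \<longleftrightarrow> ?P2"
    unfolding identifiable_iff_family_independent general_position_def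
      family_independent_iff[OF finite, symmetric]
    \<comment> \<open>A dimension count gives one direction of the inner equivalence unconditionally.\<close>
    using family_independent_card_le[OF finite, of _ ?\<phi>] by auto
  show ?thesis
    unfolding all_equivalent_def using 1 2 3 4 5 6 by simp
qed

end
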